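(* Let $X$ and $Y$ be finite dimensional normed linear spaces, and let $F:X\rightrightarrows Y$, $(\bar x,\bar y)\in\operatorname{gph}F$ and $g:Y\to\mathbb R_+$ be as in the context. Then (i) $\overline{|\partial F|}_g(\bar x,\bar y)=\inf\{\|x^*\|: x^*\in\overline D{}^{*>}_gF(\bar x,\bar y)(\mathbb S^*_{Y^*})\}$; (ii) $\overline{|\partial F|}{}^a_g(\bar x,\bar y)=\inf\{\|x^*\|: x^*\in\overline D{}^{*>a}_gF(\bar x,\bar y)(\mathbb S^*_{Y^*})\}$.
   Context: $F:X\rightrightarrows Y$ is a set-valued mapping, $\operatorname{gph}F=\{(x,y): y\in F(x)\}$, $F^{-1}(y)=\{x: y\in F(x)\}$, $(\bar x,\bar y)\in\operatorname{gph}F$. Standing assumptions on $g:Y\to\mathbb R_+=[0,\infty)$: $g(\bar y)=0$; $g$ is continuous at $\bar y$ and locally Lipschitz continuous on $Y\setminus\{\bar y\}$; $g(y)>0$ for $y\ne\bar y$; $\liminf_{g(y)\downarrow0}g(y)/\|y-\bar y\|>0$. $\partial$ is the Fréchet subdifferential: $\partial h(z)=\{z^*:\liminf_{w\to z,\,w\ne z}(h(w)-h(z)-\langle z^*,w-z\rangle)/\|w-z\|\ge0\}$; the limiting subdifferential is $\overline\partial g(v)=\{v^*\in Y^*:\exists (v_k,v_k^* )\to(v,v^* )\text{ with }v_k^*\in\partial g(v_k)\}$. The Fréchet normal cone to $\Omega$ at $z\in\Omega$ is $N_\Omega(z)=\{z^*:\limsup_{w\to z,\,w\in\Omega\setminus\{z\}}\langle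 z^*,w-z\rangle/\|w-z\|\le0\}$. The Fréchet coderivative is $D^*F(x,y)(y^* )=\{x^*\in X^*:(x^*,-y^* )\in N_{\operatorname{gph}F}(x,y)\}$. For a set-valued mapping $T$ and a set $A$, $T(A)=\bigcup_{a\in A}T(a)$. $\mathbb B^*$ and $\mathbb S^*_{Y^*}$ are the closed unit ball and the unit sphere of $Y^*$. Infimum over the empty set is $+\infty$. For $\rho>0$, $(x,y)\in\operatorname{gph}F$: $|\partial F|_{g,\rho}(x,y)=\inf\{\|x^*\|:x^*\in D^*F(x,y)(\partial g(y)+\rho\mathbb B^* )\}$; $|\partial F|^a_{g,\rho}(x,y)=\liminf_{y'\to y}\inf\{\|x^*\|:x^*\in D^*F(x,y)(\partial g(y')+\rho\mathbb B^* )\}$ (the value $y'=y$ is allowed). With $G_\rho=\{(x,y)\in\operatorname{gph}F:\|x-\bar x\|<\rho,\ \|y-\bar y\|<\rho,\ x\notin F^{-1}(\bar y)\}$, $\overline{|\partial F|}_g(\bar x,\bar y)=\lim_{\rho\downarrow0}\inf_{(x,y)\in G_\rho}|\partial F|_{g,\rho}(x,y)$ and $\overline{|\partial F|}{}^a_g(\bar x,\bar y)=\lim_{\rho\downarrow0}\inf_{(x,y)\in G_\rho}|\partial F|^a_{g,\rho}(x,y)$. The limiting outer $g$-coderivative $\overline D{}^{*>}_gF(\bar x,\bar y):Y^*\rightrightarrows X^*$ is defined by its graph: $(y^*,x^* )$ belongs to it iff there is a sequence $(x_k,y_k,x_k^*,y_k^*,v_k^* )\in X\times Y\times X^*\times Y^*\times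 Y^*$ such that $(x_k,y_k)\in\operatorname{gph}F$, $x_k\notin F^{-1}(\bar y)$, $x_k^*\in D^*F(x_k,y_k)(y_k^* )$, $v_k^*\in\partial g(y_k)$, $(x_k,y_k)\to(\bar x,\bar y)$, $y_k^*-v_k^*\to0$, $\|y^*\|x_k^*\to x^*$, and, if $y^*\ne0$, then either $y_k^*\ne0$ for all $k$ and $y_k^*/\|y_k^*\|\to y^*/\|y^*\|$, or $y_k^*=0$ for all $k$. The approximate limiting outer $g$-coderivative $\overline D{}^{*>a}_gF(\bar x,\bar y)$ is defined in the same way with $v_k^*\in\overline\partial g(y_k)$ in place of $v_k^*\in\partial g(y_k)$. *)

theory Defs
  imports "HOL-Analysis.Analysis"
begin

type_synonym 'a dual = "'a \<Rightarrow>\<^sub>L real"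

definition gph :: "('x \<Rightarrow> 'y set) \<Rightarrow> ('x \<times> 'y) set" where
  "gph F = {(x, y). y \<in> F x}"

definition preimage :: "('x \<Rightarrow> 'y set) \<Rightarrow> 'y \<Rightarrow> 'x set" where
  "preimage F y = {x. y \<in> F x}"

definition set_image :: "('a \<Rightarrow> 'b set) \<Rightarrow> 'a set \<Rightarrow> 'b set" where
  "set_image T A = (\<Union>a\<in>A. T a)"

definition frechet_subdiff :: "('z::real_normed_vector \<Rightarrow> real) \<Rightarrow> 'z \<Rightarrow> 'z dual set" where
  "frechet_subdiff h z =
     {z' :: 'z dual. Liminf (at z) (\<lambda>w. ereal ((h w - h z - z' (w - z)) / norm (w - z))) \<ge> 0}"

definition limiting_subdiff :: "('z::real_normed_vector \<Rightarrow> real) \<Rightarrow> 'z \<Rightarrow> 'z dual set" where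
  "limiting_subdiff h z =
     {z'. \<exists>(v :: nat \<Rightarrow> 'z) v'. v \<longlonglongrightarrow> z \<and> v' \<longlonglongrightarrow> z' \<and> (\<forall>k. v' k \<in> frechet_subdiff h (v k))}"

definition frechet_normal_cone :: "'z::real_normed_vector set \<Rightarrow> 'z \<Rightarrow> 'z dual set" where
  "frechet_normal_cone \<Omega> z =
     {z' :: 'z dual. Limsup (at z within \<Omega>) (\<lambda>w. ereal (z' (w - z) / norm (w - z))) \<le> 0}"

definition dual_pair ::
    "'x::real_normed_vector dual \<Rightarrow> 'y::real_normed_vector dual \<Rightarrow> ('x \<times> 'y) dual" where
  "dual_pair x' y' = (x' o\<^sub>L fst_blinfun) + (y' o\<^sub>L snd_blinfun)"

text \<open>The product carries the Euclidean product norm of the library. The normal cone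
  is the same for every equivalent norm on the product.\<close>

definition frechet_coderivative ::
    "('x::real_normed_vector \<Rightarrow> 'y::real_normed_vector set) \<Rightarrow> 'x \<Rightarrow> 'y \<Rightarrow> 'y dual \<Rightarrow> 'x dual set" where
  "frechet_coderivative F x y y' = {x'. dual_pair x' (- y') \<in> frechet_normal_cone (gph F) (x, y)}"

text \<open>The radius \<open>\<rho>\<close> is meant to be positive. In \<open>ereal\<close> the infimum over the empty set is \<open>\<infinity>\<close>.\<close>

definition inf_coderivative ::
    "('x::real_normed_vector \<Rightarrow> 'y::real_normed_vector set) \<Rightarrow> 'x \<Rightarrow> 'y \<Rightarrow> 'y dual set \<Rightarrow> real \<Rightarrow> ereal" where
  "inf_coderivative F x y A \<rho> =
     (INF x'\<in>set_image (frechet_coderivative F x y) {v + \<rho> *\<^sub>R b | v b. v \<in> A \<and> b \<in> cball 0 1}.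
        ereal (norm x'))"

definition subdiff_slope_at ::
    "('x::real_normed_vector \<Rightarrow> 'y::real_normed_vector set) \<Rightarrow> ('y \<Rightarrow> real) \<Rightarrow> real \<Rightarrow> 'x \<Rightarrow> 'y \<Rightarrow> ereal" where
  "subdiff_slope_at F g \<rho> x y = inf_coderivative F x y (frechet_subdiff g y) \<rho>"

text \<open>\<open>nhds y\<close> rather than \<open>at y\<close>, since \<open>y' = y\<close> is admitted in the lower limit.\<close>

definition approx_subdiff_slope_at ::
    "('x::real_normed_vector \<Rightarrow> 'y::real_normed_vector set) \<Rightarrow> ('y \<Rightarrow> real) \<Rightarrow> real \<Rightarrow> 'x \<Rightarrow> 'y \<Rightarrow> ereal" where
  "approx_subdiff_slope_at F g \<rho> x y =
     Liminf (nhds y) (\<lambda>y'. inf_coderivative F x y (frechet_subdiff g y') \<rho>)"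

definition outer_gph ::
    "('x::real_normed_vector \<Rightarrow> 'y::real_normed_vector set) \<Rightarrow> 'x \<Rightarrow> 'y \<Rightarrow> real \<Rightarrow> ('x \<times> 'y) set" where
  "outer_gph F xb yb \<rho> =
     {(x, y) \<in> gph F. norm (x - xb) < \<rho> \<and> norm (y - yb) < \<rho> \<and> x \<notin> preimage F yb}"

definition strict_outer_slope ::
    "('x::real_normed_vector \<Rightarrow> 'y::real_normed_vector set) \<Rightarrow> ('y \<Rightarrow> real) \<Rightarrow> 'x \<Rightarrow> 'y \<Rightarrow> ereal" where
  "strict_outer_slope F g xb yb =
     Lim (at_right 0) (\<lambda>\<rho>. INF (x, y)\<in>outer_gph F xb yb \<rho>. subdiff_slope_at F g \<rho> x y)"

definition approx_strict_outer_slope ::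
    "('x::real_normed_vector \<Rightarrow> 'y::real_normed_vector set) \<Rightarrow> ('y \<Rightarrow> real) \<Rightarrow> 'x \<Rightarrow> 'y \<Rightarrow> ereal" where
  "approx_strict_outer_slope F g xb yb =
     Lim (at_right 0) (\<lambda>\<rho>. INF (x, y)\<in>outer_gph F xb yb \<rho>. approx_subdiff_slope_at F g \<rho> x y)"

text \<open>The limits above exist, the functions of \<open>\<rho>\<close> being nonincreasing on \<open>\<rho> > 0\<close>.\<close>

lemma tendsto_SUP_at_right_0:
  fixes f :: "real \<Rightarrow> ereal"
  assumes "\<And>r s. 0 < r \<Longrightarrow> r \<le> s \<Longrightarrow> f s \<le> f r"
  shows "(f \<longlongrightarrow> (SUP r\<in>{0<..}. f r)) (at_right 0)"
proof (rule order_tendstoI)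
  fix a assume "a < (SUP r\<in>{0<..}. f r)"
  then obtain s where s: "s > 0" "a < f s" by (auto simp: less_SUP_iff)
  have "a < f r" if "0 < r" "r < s" for r
    using assms[of r s] that by (intro less_le_trans[OF s(2)]) auto
  then show "eventually (\<lambda>r. a < f r) (at_right 0)"
    using s(1) unfolding eventually_at_right_field by blast
next
  fix a assume a: "(SUP r\<in>{0<..}. f r) < a"
  have "f r < a" if "r > 0" for r
    using a that by (intro le_less_trans[OF SUP_upper a]) auto
  then show "eventually (\<lambda>r. f r < a) (at_right 0)"
    unfolding eventually_at_right_field by (blast intro: zero_less_one)
qed

lemma inf_coderivative_antimono:
  assumes "0 < r" "r \<le> s"
  shows "inf_coderivative F x y A s \<le> inf_coderivative F x y A r"
proof -
  have "{v + r *\<^sub>R b | v b. v \<in> A \<and> b \<in> cball 0 1} \<subseteq> {v + s *\<^sub>R b | v b. v \<in> A \<and> b \<in> cball 0 1}"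
  proof clarify
    fix v b assume "v \<in> A" "b \<in> cball (0 :: 'b dual) 1"
    moreover have "(r / s) * norm b \<le> 1 * 1"
      using assms calculation by (intro mult_mono) auto
    ultimately have "v + r *\<^sub>R b = v + s *\<^sub>R ((r / s) *\<^sub>R b)" "(r / s) *\<^sub>R b \<in> cball 0 1"
      using assms by auto
    then show "\<exists>v' b'. v + r *\<^sub>R b = v' + s *\<^sub>R b' \<and> v' \<in> A \<and> b' \<in> cball 0 1"
      using \<open>v \<in> A\<close> by blast
  qed
  then show ?thesis
    unfolding inf_coderivative_def set_image_def by (intro INF_superset_mono UN_mono order_refl)
qed

lemma outer_gph_mono: "r \<le> s \<Longrightarrow> outer_gph F xb yb r \<subseteq> outer_gph F xb yb s"
  by (auto simp: outer_gph_def)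

lemma strict_outer_slope_tendsto:
  "((\<lambda>\<rho>. INF (x, y)\<in>outer_gph F xb yb \<rho>. subdiff_slope_at F g \<rho> x y)
     \<longlongrightarrow> strict_outer_slope F g xb yb) (at_right 0)"
proof -
  have "((\<lambda>\<rho>. INF (x, y)\<in>outer_gph F xb yb \<rho>. subdiff_slope_at F g \<rho> x y)
     \<longlongrightarrow> (SUP \<rho>\<in>{0<..}. INF (x, y)\<in>outer_gph F xb yb \<rho>. subdiff_slope_at F g \<rho> x y)) (at_right 0)"
    by (intro tendsto_SUP_at_right_0 INF_superset_mono outer_gph_mono)
      (auto simp: subdiff_slope_at_def intro: inf_coderivative_antimono)
  then show ?thesis
    unfolding strict_outer_slope_def
    by (simp add: tendsto_Lim[OF trivial_limit_at_right_real])
qed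

lemma approx_strict_outer_slope_tendsto:
  "((\<lambda>\<rho>. INF (x, y)\<in>outer_gph F xb yb \<rho>. approx_subdiff_slope_at F g \<rho> x y)
     \<longlongrightarrow> approx_strict_outer_slope F g xb yb) (at_right 0)"
proof -
  have "((\<lambda>\<rho>. INF (x, y)\<in>outer_gph F xb yb \<rho>. approx_subdiff_slope_at F g \<rho> x y)
     \<longlongrightarrow> (SUP \<rho>\<in>{0<..}. INF (x, y)\<in>outer_gph F xb yb \<rho>. approx_subdiff_slope_at F g \<rho> x y)) (at_right 0)"
    by (intro tendsto_SUP_at_right_0 INF_superset_mono outer_gph_mono)
      (auto simp: approx_subdiff_slope_at_def intro!: Liminf_mono always_eventually inf_coderivative_antimono)
  then show ?thesis
    unfolding approx_strict_outer_slope_def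
    by (simp add: tendsto_Lim[OF trivial_limit_at_right_real])
qed

text \<open>Common form of the two limiting outer coderivatives; \<open>S\<close> is the subdifferential
  mapping of \<open>g\<close> from which the \<open>v'\<close> are taken.\<close>

definition limiting_outer_coderivative_wrt ::
    "('y::real_normed_vector \<Rightarrow> 'y dual set) \<Rightarrow> ('x::real_normed_vector \<Rightarrow> 'y set) \<Rightarrow> 'x \<Rightarrow> 'y
      \<Rightarrow> 'y dual \<Rightarrow> 'x dual set" where
  "limiting_outer_coderivative_wrt S F xb yb ys =
     {xs. \<exists>(x :: nat \<Rightarrow> 'x) (y :: nat \<Rightarrow> 'y) (x' :: nat \<Rightarrow> 'x dual)
            (y' :: nat \<Rightarrow> 'y dual) (v' :: nat \<Rightarrow> 'y dual).
        (\<forall>k. (x k, y k) \<in> gph F) \<and>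
        (\<forall>k. x k \<notin> preimage F yb) \<and>
        (\<forall>k. x' k \<in> frechet_coderivative F (x k) (y k) (y' k)) \<and>
        (\<forall>k. v' k \<in> S (y k)) \<and>
        (\<lambda>k. (x k, y k)) \<longlonglongrightarrow> (xb, yb) \<and>
        (\<lambda>k. y' k - v' k) \<longlonglongrightarrow> 0 \<and>
        (\<lambda>k. norm ys *\<^sub>R x' k) \<longlonglongrightarrow> xs \<and>
        (ys \<noteq> 0 \<longrightarrow>
           (\<forall>k. y' k \<noteq> 0) \<and> (\<lambda>k. y' k /\<^sub>R norm (y' k)) \<longlonglongrightarrow> ys /\<^sub>R norm ys \<or>
           (\<forall>k. y' k = 0))}"

definition limiting_outer_coderivative ::
    "('x::real_normed_vector \<Rightarrow> 'y::real_normed_vector set) \<Rightarrow> ('y \<Rightarrow> real) \<Rightarrow> 'x \<Rightarrow> 'y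
      \<Rightarrow> 'y dual \<Rightarrow> 'x dual set" where
  "limiting_outer_coderivative F g = limiting_outer_coderivative_wrt (frechet_subdiff g) F"

definition approx_limiting_outer_coderivative ::
    "('x::real_normed_vector \<Rightarrow> 'y::real_normed_vector set) \<Rightarrow> ('y \<Rightarrow> real) \<Rightarrow> 'x \<Rightarrow> 'y
      \<Rightarrow> 'y dual \<Rightarrow> 'x dual set" where
  "approx_limiting_outer_coderivative F g = limiting_outer_coderivative_wrt (limiting_subdiff g) F"

end

theory Submission imports Defs begin

text \<open>For either subdifferential, both sides of the equality are at most a real number \<open>L\<close> under the
  same \<open>\<epsilon>\<close>-condition on quintuples \<open>(x, y, v, y', x')\<close>. Passing from this condition to the limiting
  coderivative, compactness of the dual balls makes the \<open>x'\<close> and the normalized \<open>y'\<close> converge along a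
  subsequence. For the approximate slope, subgradients of \<open>g\<close> at points near \<open>y \<noteq> yb\<close> are bounded by
  the local Lipschitz constant, hence cluster at a limiting subgradient at \<open>y\<close>.\<close>

section \<open>Normed spaces with a finite spanning set: dual bases and convergent
  subsequences\<close>

text \<open>Some ball of radius \<open>d\<close> about \<open>b\<close> misses \<open>S\<close>. For
  a \<noteq> 0 the point -s/a lies in \<open>S\<close>, so its distance to \<open>b\<close>, which
  is the norm of \<open>a *\<^sub>R b + s\<close> divided by the modulus of \<open>a\<close>, is at
  least \<open>d\<close>. The bound controls the coefficient of \<open>b\<close> by the norm of the
  whole vector.\<close>

lemma distance_to_closed_subspace:
  fixes S :: "'a::real_normed_vector set"
  assumes "closed S" "subspace S" "b \<notin> S"
  obtains d where "d > 0" "\<And>a s. s \<in> S \<Longrightarrow> d * \<bar>a\<bar> \<le> norm (a *\<^sub>R b + s)"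
proof -
  have "open (- S)" "b \<in> - S"
    using assms by (auto simp: closed_def)
  then obtain d where d: "d > 0" "\<forall>u. dist u b < d \<longrightarrow> u \<in> - S"
    unfolding open_dist by blast
  have "d * \<bar>a\<bar> \<le> norm (a *\<^sub>R b + s)" if s: "s \<in> S" for a s
  proof (cases "a = 0")
    case False
    have "(- (1 / a)) *\<^sub>R s \<in> S"
      using assms(2) s by (rule subspace_scale)
    then have "d \<le> dist ((- (1 / a)) *\<^sub>R s) b"
      using d(2) by (meson ComplD not_le)
    also have "\<dots> = norm ((1 / a) *\<^sub>R (a *\<^sub>R b + s))"
      using False by (simp add: dist_norm scaleR_add_right norm_minus_commute)
    also have "\<dots> = norm (a *\<^sub>R b + s) / \<bar>a\<bar>"
      by (simp add: divide_inverse_commute)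
    finally show ?thesis
      using False by (simp add: field_simps)
  qed simp
  then show thesis
    using that d(1) by blast
qed

text \<open>Induction on \<open>B\<close>. The smaller span is complete, hence closed, so the
  distance bound makes the \<open>b\<close>-coefficients of a Cauchy sequence Cauchy in the reals;
  the remainders are then Cauchy in the smaller span. What is needed later is that such spans are
  closed.\<close>

lemma complete_span_finite:
  fixes B :: "'a::real_normed_vector set"
  assumes "finite B"
  shows "complete (span B)"
  using assms
proof (induction B)
  case empty
  then show ?case by (simp add: compact_imp_complete)
next
  case (insert b B)
  show ?case
  proof (cases "b \<in> span B")
    case True
    then show ?thesis using insert.IH by (simp add: span_redundant)
  next
    case False
    obtain d where d: "d > 0" "\<And>a s. s \<in> span B \<Longrightarrow> d * \<bar>a\<bar> \<le> norm (a *\<^sub>R b + s)"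
      using distance_to_closed_subspace[OF complete_imp_closed[OF insert.IH] subspace_span False]
      by blast
    show ?thesis
      unfolding complete_def
    proof (intro allI impI, elim conjE)
      fix f :: "nat \<Rightarrow> 'a"
      assume f: "\<forall>n. f n \<in> span (insert b B)" and "Cauchy f"
      from f have "\<exists>a. \<forall>n. f n - a n *\<^sub>R b \<in> span B"
        by (intro choice) (simp add: span_breakdown_eq)
      then obtain a where a: "\<And>n. f n - a n *\<^sub>R b \<in> span B"
        by blast
      have "Cauchy a"
      proof (rule metric_CauchyI)
        fix e :: real assume "e > 0"
        then obtain M where M: "\<And>m n. m \<ge> M \<Longrightarrow> n \<ge> M \<Longrightarrow> dist (f m) (f n) < d * e"
          using \<open>Cauchy f\<close> d(1) unfolding Cauchy_def by (metis mult_pos_pos)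
        have "dist (a m) (a n) < e" if "m \<ge> M" "n \<ge> M" for m n
        proof -
          \<comment> \<open>The vector \<open>f m - f n\<close> is
            \<open>(a m - a n) *\<^sub>R b\<close> plus a difference of two remainders, which lies
            in \<open>span B\<close>.\<close>
          have "d * \<bar>a m - a n\<bar>
              \<le> norm ((a m - a n) *\<^sub>R b + ((f m - a m *\<^sub>R b) - (f n - a n *\<^sub>R b)))"
            by (intro d(2) span_diff a)
          also have "\<dots> = dist (f m) (f n)"
            by (simp add: dist_norm algebra_simps)
          also have "\<dots> < d * e"
            using M that by blast
          finally show ?thesis
            using d(1) by (simp add: dist_real_def)
        qed
        then show "\<exists>M. \<forall>m\<ge>M. \<forall>n\<ge>M. dist (a m) (a n) < e"
          by blast
      qed
      then obtain \<alpha> where \<alpha>: "a \<longlonglongrightarrow> \<alpha>"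
        using Cauchy_convergent convergent_def by blast
      have ab: "(\<lambda>n. a n *\<^sub>R b) \<longlonglongrightarrow> \<alpha> *\<^sub>R b"
        by (intro tendsto_intros \<alpha>)
      have "Cauchy (\<lambda>n. f n - a n *\<^sub>R b)"
      proof (rule metric_CauchyI)
        fix e :: real assume "e > 0"
        obtain M where M: "\<And>m n. m \<ge> M \<Longrightarrow> n \<ge> M \<Longrightarrow> dist (f m) (f n) < e / 2"
          using \<open>Cauchy f\<close> \<open>e > 0\<close> unfolding Cauchy_def by (metis half_gt_zero)
        obtain N where N: "\<And>m n. m \<ge> N \<Longrightarrow> n \<ge> N \<Longrightarrow> dist (a m *\<^sub>R b) (a n *\<^sub>R b) < e / 2"
          using LIMSEQ_imp_Cauchy[OF ab] \<open>e > 0\<close> unfolding Cauchy_def by (metis half_gt_zero)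
        have "dist (f m - a m *\<^sub>R b) (f n - a n *\<^sub>R b) < e" if "m \<ge> max M N" "n \<ge> max M N" for m n
        proof -
          have "dist (f m - a m *\<^sub>R b) (f n - a n *\<^sub>R b)
              \<le> dist (f m) (f n) + dist (a m *\<^sub>R b) (a n *\<^sub>R b)"
            unfolding dist_norm
            using norm_triangle_ineq4[of "f m - f n" "a m *\<^sub>R b - a n *\<^sub>R b"]
            by (simp add: algebra_simps)
          then show ?thesis
            using M[of m n] N[of m n] that by simp
        qed
        then show "\<exists>M. \<forall>m\<ge>M. \<forall>n\<ge>M. dist (f m - a m *\<^sub>R b) (f n - a n *\<^sub>R b) < e"
          by blast
      qed
      then obtain s where s: "s \<in> span B" "(\<lambda>n. f n - a n *\<^sub>R b) \<longlonglongrightarrow> s"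
        using insert.IH a unfolding complete_def by meson
      have "f \<longlonglongrightarrow> s + \<alpha> *\<^sub>R b"
        using tendsto_add[OF s(2) ab] by simp
      moreover have "s + \<alpha> *\<^sub>R b \<in> span (insert b B)"
        unfolding span_breakdown_eq using s(1) by (intro exI[of _ \<alpha>]) simp
      ultimately show "\<exists>l\<in>span (insert b B). f \<longlonglongrightarrow> l"
        by blast
    qed
  qed
qed

text \<open>Each basis vector has positive distance from the closed span of the others, so its
  coordinate is a bounded functional. These coordinates form the dual basis, and a functional is
  recovered from its values on \<open>B\<close>. The two identities give the dual space real
  coordinates.\<close>

lemma finite_dim_dual_basis:
  assumes "\<exists>C :: 'a::real_normed_vector set. finite C \<and> span C = UNIV"
  obtains B :: "'a::real_normed_vector set" and \<phi> :: "'a::real_normed_vector \<Rightarrow> 'a dual"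
  where "finite B" "span B = UNIV"
    "\<And>b c. b \<in> B \<Longrightarrow> c \<in> B \<Longrightarrow> \<phi> b c = (if c = b then 1 else 0)"
    "\<And>f. (\<Sum>b\<in>B. blinfun_apply f b *\<^sub>R \<phi> b) = f"
proof -
  obtain C :: "'a set" where C: "finite C" "span C = UNIV"
    using assms by blast
  obtain B where B: "B \<subseteq> C" "independent B" "C \<subseteq> span B"
    using maximal_independent_subset[of C] by blast
  have fin: "finite B"
    using B(1) C(1) by (rule finite_subset)
  have sp: "span B = UNIV"
    using span_mono[OF B(3)] C(2) by (simp add: span_span top.extremum_uniqueI)
  define r where "r = representation B"
  have sum_r: "(\<Sum>c\<in>B. r x c *\<^sub>R c) = x" for x
    unfolding r_def using B(2) sp fin by (intro sum_representation_eq) auto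
  have bl: "bounded_linear (\<lambda>x. r x b)" if b: "b \<in> B" for b
  proof -
    have "b \<notin> span (B - {b})"
      using B(2) b by (auto simp: dependent_def)
    then obtain d where d: "d > 0"
      "\<And>a s. s \<in> span (B - {b}) \<Longrightarrow> d * \<bar>a\<bar> \<le> norm (a *\<^sub>R b + s)"
      using distance_to_closed_subspace[OF complete_imp_closed[OF complete_span_finite] subspace_span]
        fin by (metis finite_Diff)
    \<comment> \<open>Split \<open>x\<close> into its \<open>b\<close>-component and a rest in the
      span of \<open>B - {b}\<close>; the distance bound then applies to the sum.\<close>
    have bd: "norm (r x b) \<le> norm x * (1 / d)" for x
    proof -
      have "(\<Sum>c\<in>B - {b}. r x c *\<^sub>R c) \<in> span (B - {b})"
        by (intro span_sum span_scale span_base)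
      then have "d * \<bar>r x b\<bar> \<le> norm (r x b *\<^sub>R b + (\<Sum>c\<in>B - {b}. r x c *\<^sub>R c))"
        by (rule d(2))
      also have "\<dots> = norm x"
        using sum_r[of x] sum.remove[OF fin b, of "\<lambda>c. r x c *\<^sub>R c"] by simp
      finally show ?thesis
        using d(1) by (simp add: field_simps)
    qed
    have "r (x + y) b = r x b + r y b" "r (a *\<^sub>R x) b = a *\<^sub>R r x b" for x y a
      unfolding r_def using B(2) sp by (auto simp: representation_add representation_scale)
    then show ?thesis
      using bd by (rule bounded_linear_intro)
  qed
  define \<phi> where "\<phi> b = Blinfun (\<lambda>x. r x b)" for b
  have \<phi>: "blinfun_apply (\<phi> b) x = r x b" if "b \<in> B" for b x
    unfolding \<phi>_def by (simp add: bounded_linear_Blinfun_apply[OF bl[OF that]])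
  show thesis
  proof (rule that[OF fin sp])
    show "\<phi> b c = (if c = b then 1 else 0)" if "b \<in> B" "c \<in> B" for b c
      using that B(2) by (simp add: \<phi>) (simp add: r_def representation_basis)
    show "(\<Sum>b\<in>B. blinfun_apply f b *\<^sub>R \<phi> b) = f" for f :: "'a dual"
    proof (rule blinfun_eqI)
      fix x
      have "(\<Sum>b\<in>B. blinfun_apply f b *\<^sub>R \<phi> b) x = (\<Sum>b\<in>B. f b * r x b)"
        by (simp add: blinfun.sum_left blinfun.scaleR_left \<phi>)
      also have "\<dots> = f (\<Sum>b\<in>B. r x b *\<^sub>R b)"
        by (simp add: blinfun.sum_right blinfun.scaleR_right mult.commute)
      finally show "(\<Sum>b\<in>B. blinfun_apply f b *\<^sub>R \<phi> b) x = f x"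
        by (simp add: sum_r)
    qed
  qed
qed

text \<open>Norm-bounded functionals have bounded values at each of the finitely many basis vectors,
  so some subsequence converges at all of them. Expansion in the dual basis turns this into
  convergence in norm.\<close>

lemma finite_dim_dual_bounded_subseq:
  fixes f :: "nat \<Rightarrow> 'a::real_normed_vector dual"
  assumes "\<exists>C :: 'a set. finite C \<and> span C = UNIV" and bdd: "\<And>n. norm (f n) \<le> M"
  obtains l r where "strict_mono (r :: nat \<Rightarrow> nat)" "(\<lambda>n. f (r n)) \<longlonglongrightarrow> l"
proof -
  obtain B :: "'a set" and \<phi> :: "'a \<Rightarrow> 'a dual" where B: "finite B" "span B = UNIV"
    "\<And>b c. b \<in> B \<Longrightarrow> c \<in> B \<Longrightarrow> \<phi> b c = (if c = b then 1 else 0)"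
    "\<And>f. (\<Sum>b\<in>B. blinfun_apply f b *\<^sub>R \<phi> b) = f"
    by (fact finite_dim_dual_basis[OF assms(1)])
  \<comment> \<open>Coordinates are the values at the vectors of \<open>B\<close>, and
    \<open>unproj\<close> rebuilds the functional from them; the two dual basis identities say that
    these operations are inverse to each other.\<close>
  have "\<forall>D\<subseteq>B. \<exists>l. \<exists>r::nat \<Rightarrow> nat. strict_mono r \<and>
      (\<forall>e>0. eventually (\<lambda>n. \<forall>b\<in>D. dist (blinfun_apply (f (r n)) b) (blinfun_apply l b) < e) sequentially)"
  proof (rule compact_lemma_general[where proj = blinfun_apply
        and unproj = "\<lambda>e. \<Sum>b\<in>B. e b *\<^sub>R \<phi> b", OF B(1)])
    show "bounded ((\<lambda>x. blinfun_apply x b) ` range f)" for b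
    proof (rule boundedI)
      fix y assume "y \<in> (\<lambda>x. blinfun_apply x b) ` range f"
      then obtain n where "y = f n b" by blast
      then show "norm y \<le> M * norm b"
        using norm_blinfun[of "f n" b] mult_right_mono[OF bdd[of n] norm_ge_zero[of b]] by simp
    qed
    show "blinfun_apply (\<Sum>b\<in>B. e b *\<^sub>R \<phi> b) k = e k" if k: "k \<in> B" for e :: "'a \<Rightarrow> real" and k
    proof -
      have "blinfun_apply (\<Sum>b\<in>B. e b *\<^sub>R \<phi> b) k = (\<Sum>b\<in>B. if k = b then e b else 0)"
        using k by (auto simp: blinfun.sum_left blinfun.scaleR_left B(3) intro!: sum.cong)
      also have "\<dots> = e k"
        using B(1) k by simp
      finally show ?thesis .
    qed
  qed (simp add: B(4))
  then obtain l r where lr: "strict_mono (r :: nat \<Rightarrow> nat)"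
    "\<And>e. e > 0 \<Longrightarrow> eventually (\<lambda>n. \<forall>b\<in>B. dist (blinfun_apply (f (r n)) b) (blinfun_apply l b) < e) sequentially"
    by blast
  have "(\<lambda>n. blinfun_apply (f (r n)) b) \<longlonglongrightarrow> blinfun_apply l b" if "b \<in> B" for b
    using that by (intro tendstoI eventually_mono[OF lr(2)]) auto
  then have "(\<lambda>n. \<Sum>b\<in>B. blinfun_apply (f (r n)) b *\<^sub>R \<phi> b) \<longlonglongrightarrow> (\<Sum>b\<in>B. blinfun_apply l b *\<^sub>R \<phi> b)"
    by (intro tendsto_sum tendsto_scaleR tendsto_const)
  then have "(\<lambda>n. f (r n)) \<longlonglongrightarrow> l"
    by (simp add: B(4))
  then show thesis
    using that lr(1) by blast
qed

text \<open>In a nontrivial space the basis is nonempty, and a coordinate functional takes the value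
  1 at its own basis vector, so it can be normalized. This provides a unit \<open>ys\<close> when
  every \<open>y'\<close> vanishes and no direction can be read off from the sequence.\<close>

lemma finite_dim_dual_unit_exists:
  fixes a :: "'a::real_normed_vector"
  assumes "\<exists>C :: 'a set. finite C \<and> span C = UNIV" and "a \<noteq> 0"
  obtains f :: "'a dual" where "norm f = 1"
proof -
  obtain B :: "'a set" and \<phi> :: "'a \<Rightarrow> 'a dual" where B: "finite B" "span B = UNIV"
    "\<And>b c. b \<in> B \<Longrightarrow> c \<in> B \<Longrightarrow> \<phi> b c = (if c = b then 1 else 0)"
    "\<And>f. (\<Sum>b\<in>B. blinfun_apply f b *\<^sub>R \<phi> b) = f"
    by (fact finite_dim_dual_basis[OF assms(1)])
  have "B \<noteq> {}"
    using B(2) assms(2) by (metis UNIV_I singletonD span_empty)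
  then obtain b where "b \<in> B" by blast
  then have "\<phi> b \<noteq> 0"
    using B(3)[of b b] by auto
  then show thesis
    by (intro that[of "sgn (\<phi> b)"]) (simp add: norm_sgn)
qed

text \<open>One of two complementary sets of indices is infinite and can be enumerated. This serves
  the alternative in the limiting coderivative: the \<open>y'\<close> are all zero or all
  nonzero.\<close>

lemma subseq_all_or_none:
  obtains r where "strict_mono (r :: nat \<Rightarrow> nat)" "(\<forall>n. P (r n)) \<or> (\<forall>n. \<not> P (r n))"
proof -
  have "{n. P n} \<union> {n. \<not> P n} = UNIV"
    by blast
  then have "infinite {n. P n} \<or> infinite {n. \<not> P n}"
    using infinite_UNIV_nat finite_UnI by metis
  then show thesis
  proof
    assume "infinite {n. P n}"
    then show thesis
      using that[of "enumerate {n. P n}"] enumerate_in_set strict_mono_enumerate by blast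
  next
    assume "infinite {n. \<not> P n}"
    then show thesis
      using that[of "enumerate {n. \<not> P n}"] enumerate_in_set strict_mono_enumerate by blast
  qed
qed

section \<open>Bounds on Frechet subgradients and on infima over coderivatives\<close>

text \<open>A short step from \<open>w\<close> in direction \<open>h\<close> raises \<open>g\<close>
  by at most \<open>L\<close> times its length, while the subgradient inequality forces a rise of at
  least \<open>v\<close> on that step, up to a small relative error.\<close>

lemma frechet_subgradient_norm_le_Lipschitz:
  fixes g :: "'a::real_normed_vector \<Rightarrow> real"
  assumes lip: "L-lipschitz_on U g" and U: "open U" "w \<in> U" and v: "v \<in> frechet_subdiff g w"
  shows "norm v \<le> L"
proof (rule norm_blinfun_bound)
  show "0 \<le> L"
    using lip by (rule lipschitz_on_nonneg)
  fix h
  show "norm (blinfun_apply v h) \<le> L * norm h"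
  proof (cases "h = 0")
    case False
    have le: "blinfun_apply v h \<le> L * norm h" if h: "h \<noteq> 0" for h
    proof (rule field_le_epsilon)
      fix e :: real assume e: "e > 0"
      \<comment> \<open>The tolerance is scaled by \<open>norm h\<close> so that multiplying by the
        length of the step \<open>t *\<^sub>R h\<close> leaves the error
        \<open>e * t\<close>.\<close>
      have "eventually (\<lambda>u. ereal (- (e / norm h)) < ereal ((g u - g w - v (u - w)) / norm (u - w))) (at w)"
        using v e h unfolding frechet_subdiff_def le_Liminf_iff mem_Collect_eq
        by (elim allE[of _ "ereal (- (e / norm h))"] impE) auto
      moreover have "eventually (\<lambda>u. u \<in> U) (at w)"
        using U by (simp add: eventually_at_topological) blast
      ultimately have "eventually (\<lambda>u. u \<in> U \<and> - (e / norm h) < (g u - g w - v (u - w)) / norm (u - w)) (at w)"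
        by eventually_elim simp
      then obtain \<delta> where \<delta>: "\<delta> > 0" "\<And>u. u \<noteq> w \<Longrightarrow> dist u w < \<delta> \<Longrightarrow>
          u \<in> U \<and> - (e / norm h) < (g u - g w - v (u - w)) / norm (u - w)"
        unfolding eventually_at by auto
      \<comment> \<open>The step has length \<delta>/2, inside the punctured ball where the quotient
        bound holds.\<close>
      define t where "t = \<delta> / (2 * norm h)"
      have t: "t > 0" "t * norm h < \<delta>"
        using \<delta>(1) h by (simp_all add: t_def)
      let ?u = "w + t *\<^sub>R h"
      have *: "?u \<in> U" "- (e / norm h) < (g ?u - g w - v (t *\<^sub>R h)) / norm (t *\<^sub>R h)"
        using \<delta>(2)[of ?u] t h by (simp_all add: dist_norm)
      have "g ?u - g w \<le> L * (t * norm h)"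
        using lipschitz_onD[OF lip *(1) U(2)] t(1) by (simp add: dist_norm)
      moreover have "- (e * t) < g ?u - g w - t * blinfun_apply v h"
        using *(2) t(1) h by (simp add: field_simps blinfun.scaleR_right)
      ultimately have "t * blinfun_apply v h < t * (L * norm h + e)"
        by (simp add: algebra_simps)
      then show "blinfun_apply v h \<le> L * norm h + e"
        using t(1) by simp
    qed
    \<comment> \<open>The one-sided estimate at \<open>h\<close> and at \<open>- h\<close> bounds
      the absolute value.\<close>
    show ?thesis
      using le[of h] le[of "- h"] False by (simp add: blinfun.minus_right abs_le_iff)
  qed simp
qed

text \<open>A strict upper bound on an infimum is always witnessed by an element, which a non-strict
  one need not be. Division by \<rho> > 0 identifies the enlarged set with the points within \<rho>
  of some element of \<open>A\<close>.\<close>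

lemma inf_coderivative_less_iff:
  assumes "\<rho> > 0"
  shows "inf_coderivative F x y A \<rho> < c \<longleftrightarrow>
    (\<exists>v y' x'. v \<in> A \<and> norm (y' - v) \<le> \<rho> \<and> x' \<in> frechet_coderivative F x y y' \<and> ereal (norm x') < c)"
    (is "_ \<longleftrightarrow> ?R")
proof -
  have eq: "{v + \<rho> *\<^sub>R b | v b. v \<in> A \<and> b \<in> cball 0 1} = {y'. \<exists>v\<in>A. norm (y' - v) \<le> \<rho>}"
  proof (intro set_eqI iffI)
    fix u assume "u \<in> {v + \<rho> *\<^sub>R b | v b. v \<in> A \<and> b \<in> cball 0 1}"
    then obtain v b where "v \<in> A" "u = v + \<rho> *\<^sub>R b" "norm b \<le> 1"
      by auto
    then show "u \<in> {y'. \<exists>v\<in>A. norm (y' - v) \<le> \<rho>}"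
      using assms by (auto simp: mult_left_le intro!: bexI[of _ v])
  next
    fix u assume "u \<in> {y'. \<exists>v\<in>A. norm (y' - v) \<le> \<rho>}"
    then obtain v where v: "v \<in> A" "norm (u - v) \<le> \<rho>" by blast
    have "u = v + \<rho> *\<^sub>R ((1 / \<rho>) *\<^sub>R (u - v))" "(1 / \<rho>) *\<^sub>R (u - v) \<in> cball 0 1"
      using v(2) assms by (simp_all del: scaleR_right_diff_distrib)
    then show "u \<in> {v + \<rho> *\<^sub>R b | v b. v \<in> A \<and> b \<in> cball 0 1}"
      using v(1) by blast
  qed
  show ?thesis
    unfolding inf_coderivative_def eq INF_less_iff set_image_def by blast
qed

section \<open>The slopes and the \<epsilon>-condition\<close>

text \<open>One \<epsilon> serves as radius of the neighbourhood, as distance from \<open>y'\<close>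
  to a subgradient and as excess over \<open>L\<close>, so the condition at a smaller \<epsilon>
  implies it at a larger one. Taking \<open>S\<close> as the Frechet or the limiting subdifferential
  gives the two cases of the theorem.\<close>

definition outer_approachable ::
    "('y::real_normed_vector \<Rightarrow> 'y dual set) \<Rightarrow> ('x::real_normed_vector \<Rightarrow> 'y set) \<Rightarrow> 'x \<Rightarrow> 'y \<Rightarrow> real \<Rightarrow> bool" where
  "outer_approachable S F xb yb L \<longleftrightarrow>
     (\<forall>\<epsilon>>0. \<exists>x y v y' x'. (x, y) \<in> outer_gph F xb yb \<epsilon> \<and> v \<in> S y \<and> norm (y' - v) \<le> \<epsilon> \<and>
        x' \<in> frechet_coderivative F x y y' \<and> norm x' < L + \<epsilon>)"

lemma outer_approachableD:
  assumes "outer_approachable S F xb yb L" "\<epsilon> > 0"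
  obtains x y v y' x' where "(x, y) \<in> outer_gph F xb yb \<epsilon>" "v \<in> S y" "norm (y' - v) \<le> \<epsilon>"
    "x' \<in> frechet_coderivative F x y y'" "norm x' < L + \<epsilon>"
  using assms unfolding outer_approachable_def by metis

text \<open>The last conclusion holds because \<open>F x\<close> contains \<open>y\<close> but not
  \<open>yb\<close>; it puts \<open>y\<close> where \<open>g\<close> is locally Lipschitz.\<close>

lemma outer_gphD:
  assumes "(x, y) \<in> outer_gph F xb yb \<epsilon>"
  shows "(x, y) \<in> gph F" "x \<notin> preimage F yb" "norm (x - xb) < \<epsilon>" "norm (y - yb) < \<epsilon>" "y \<noteq> yb"
  using assms by (auto simp: outer_gph_def gph_def preimage_def)

text \<open>The infimum grows as \<rho> decreases, so the limit is a supremum over \<rho> > 0, and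
  it is at most \<open>L\<close> exactly when every infimum is. By the same monotonicity the slack
  above \<open>L\<close> may be tied to the radius, and the resulting strict bounds have
  witnesses.\<close>

lemma Lim_INF_outer_gph_le_iff:
  fixes h :: "real \<Rightarrow> 'x::real_normed_vector \<Rightarrow> 'y::real_normed_vector \<Rightarrow> ereal"
  assumes mono: "\<And>r s x y. 0 < r \<Longrightarrow> r \<le> s \<Longrightarrow> h s x y \<le> h r x y"
  shows "Lim (at_right 0) (\<lambda>\<rho>. INF (x, y)\<in>outer_gph F xb yb \<rho>. h \<rho> x y) \<le> ereal L \<longleftrightarrow>
    (\<forall>\<epsilon>>0. \<exists>x y. (x, y) \<in> outer_gph F xb yb \<epsilon> \<and> h \<epsilon> x y < ereal (L + \<epsilon>))"
proof -
  let ?f = "\<lambda>\<rho>. INF (x, y)\<in>outer_gph F xb yb \<rho>. h \<rho> x y"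
  have less_iff: "?f \<epsilon> < c \<longleftrightarrow> (\<exists>x y. (x, y) \<in> outer_gph F xb yb \<epsilon> \<and> h \<epsilon> x y < c)" for \<epsilon> c
    by (auto simp: INF_less_iff Bex_def)
  have "(?f \<longlongrightarrow> (SUP \<rho>\<in>{0<..}. ?f \<rho>)) (at_right 0)"
    by (intro tendsto_SUP_at_right_0 INF_superset_mono outer_gph_mono) (auto intro: mono)
  then have "Lim (at_right 0) ?f = (SUP \<rho>\<in>{0<..}. ?f \<rho>)"
    by (simp add: tendsto_Lim[OF trivial_limit_at_right_real])
  then have "Lim (at_right 0) ?f \<le> ereal L \<longleftrightarrow> (\<forall>\<rho>>0. ?f \<rho> \<le> ereal L)"
    by (auto simp: SUP_le_iff)
  also have "\<dots> \<longleftrightarrow> (\<forall>\<epsilon>>0. ?f \<epsilon> < ereal (L + \<epsilon>))"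
  proof (intro iffI allI impI)
    fix \<epsilon> :: real assume "\<forall>\<rho>>0. ?f \<rho> \<le> ereal L" "\<epsilon> > 0"
    moreover from this have "ereal L < ereal (L + \<epsilon>)" by simp
    ultimately show "?f \<epsilon> < ereal (L + \<epsilon>)"
      by (meson le_less_trans)
  next
    fix \<rho> :: real assume *: "\<forall>\<epsilon>>0. ?f \<epsilon> < ereal (L + \<epsilon>)" and "\<rho> > 0"
    show "?f \<rho> \<le> ereal L"
    proof (rule ereal_le_epsilon2)
      fix e :: real assume "e > 0"
      \<comment> \<open>Passing to the smaller radius \<open>min \<rho> e\<close> only increases the
        infimum and makes the slack at most \<open>e\<close>.\<close>
      have "?f \<rho> \<le> ?f (min \<rho> e)"
        using \<open>e > 0\<close> \<open>\<rho> > 0\<close>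
        by (intro INF_superset_mono outer_gph_mono) (auto intro: mono)
      also have "\<dots> \<le> ereal (L + min \<rho> e)"
        using * \<open>e > 0\<close> \<open>\<rho> > 0\<close> by (intro less_imp_le) auto
      also have "\<dots> \<le> ereal L + ereal e"
        by simp
      finally show "?f \<rho> \<le> ereal L + ereal e" .
    qed
  qed
  also have "\<dots> \<longleftrightarrow> (\<forall>\<epsilon>>0. \<exists>x y. (x, y) \<in> outer_gph F xb yb \<epsilon> \<and> h \<epsilon> x y < ereal (L + \<epsilon>))"
    unfolding less_iff ..
  finally show ?thesis .
qed

lemma strict_outer_slope_le_iff:
  "strict_outer_slope F g xb yb \<le> ereal L \<longleftrightarrow> outer_approachable (frechet_subdiff g) F xb yb L"
  unfolding strict_outer_slope_def outer_approachable_def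
  by (subst Lim_INF_outer_gph_le_iff)
    (simp_all add: subdiff_slope_at_def inf_coderivative_less_iff inf_coderivative_antimono)

text \<open>The limiting subgradient \<open>v\<close> is approximated by Frechet subgradients at
  points tending to \<open>y\<close>. The strict inequality for \<open>y' - v\<close> persists for
  late approximants, so \<open>x'\<close> competes in infima at points arbitrarily near
  \<open>y\<close>, and the lower limit cannot exceed its norm.\<close>

lemma approx_subdiff_slope_at_le:
  assumes v: "v \<in> limiting_subdiff g y" and y': "norm (y' - v) < \<rho>"
    and x': "x' \<in> frechet_coderivative F x y y'"
  shows "approx_subdiff_slope_at F g \<rho> x y \<le> ereal (norm x')"
proof (rule ccontr)
  assume "\<not> ?thesis"
  then have "ereal (norm x') < Liminf (nhds y) (\<lambda>u. inf_coderivative F x y (frechet_subdiff g u) \<rho>)"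
    by (simp add: approx_subdiff_slope_at_def)
  then have ev: "eventually (\<lambda>u. ereal (norm x') < inf_coderivative F x y (frechet_subdiff g u) \<rho>) (nhds y)"
    by (rule less_LiminfD)
  obtain w u where w: "w \<longlonglongrightarrow> y" and u: "u \<longlonglongrightarrow> v" "\<And>k. u k \<in> frechet_subdiff g (w k)"
    using v unfolding limiting_subdiff_def by blast
  have "(\<lambda>k. norm (y' - u k)) \<longlonglongrightarrow> norm (y' - v)"
    by (intro tendsto_intros u)
  then have "eventually (\<lambda>k. norm (y' - u k) < \<rho>) sequentially"
    using y' by (rule order_tendstoD)
  moreover have "eventually (\<lambda>k. ereal (norm x') < inf_coderivative F x y (frechet_subdiff g (w k)) \<rho>) sequentially"
    using ev w by (rule eventually_compose_filterlim)
  ultimately have "eventually (\<lambda>k. norm (y' - u k) < \<rho> \<and>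
      ereal (norm x') < inf_coderivative F x y (frechet_subdiff g (w k)) \<rho>) sequentially"
    by (rule eventually_conj)
  then obtain k where k: "norm (y' - u k) < \<rho>"
    "ereal (norm x') < inf_coderivative F x y (frechet_subdiff g (w k)) \<rho>"
    by (auto dest: eventually_happens)
  have "\<rho> > 0"
    using y' norm_ge_zero[of "y' - v"] by linarith
  \<comment> \<open>A witnessed bound is strict, so a value strictly between \<open>norm x'\<close>
    and the infimum is inserted to reach the contradiction.\<close>
  then obtain c where c: "ereal (norm x') < c" "c < inf_coderivative F x y (frechet_subdiff g (w k)) \<rho>"
    using k(2) dense by blast
  have "inf_coderivative F x y (frechet_subdiff g (w k)) \<rho> < c"
    unfolding inf_coderivative_less_iff[OF \<open>\<rho> > 0\<close>] using u(2) k(1) x' c(1) by (meson less_imp_le)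
  then show False
    using c(2) by simp
qed

text \<open>Points near \<open>y\<close> supply Frechet subgradients bounded by the Lipschitz
  constant; a cluster point of them is a limiting subgradient at \<open>y\<close>. The gap between
  \<rho> and \<sigma> absorbs the distance to the cluster point.\<close>

lemma approx_subdiff_slope_at_less:
  fixes g :: "'y::real_normed_vector \<Rightarrow> real"
  assumes fin: "\<exists>B :: 'y set. finite B \<and> span B = UNIV"
    and lip: "L-lipschitz_on U g" "open U" "y \<in> U"
    and less: "approx_subdiff_slope_at F g \<rho> x y < c" and \<rho>: "0 < \<rho>" "\<rho> < \<sigma>"
  obtains v y' x' where "v \<in> limiting_subdiff g y" "norm (y' - v) \<le> \<sigma>"
    "x' \<in> frechet_coderivative F x y y'" "ereal (norm x') < c"
proof -
  let ?h = "\<lambda>u. inf_coderivative F x y (frechet_subdiff g u) \<rho>"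
  obtain \<delta> where \<delta>: "\<delta> > 0" "ball y \<delta> \<subseteq> U"
    using lip(2,3) open_contains_ball by blast
  \<comment> \<open>If the values were at least \<open>c\<close> on a whole neighbourhood of
    \<open>y\<close>, the lower limit would be too.\<close>
  have freq: "\<exists>w. dist w y < e \<and> ?h w < c" if "e > 0" for e
  proof (rule ccontr)
    assume "\<not> ?thesis"
    then have "\<forall>w. dist w y < e \<longrightarrow> c \<le> ?h w"
      by (meson not_le)
    then have "eventually (\<lambda>w. c \<le> ?h w) (nhds y)"
      unfolding eventually_nhds_metric using that by blast
    then have "c \<le> approx_subdiff_slope_at F g \<rho> x y"
      unfolding approx_subdiff_slope_at_def by (rule Liminf_bounded)
    then show False
      using less by simp
  qed
  \<comment> \<open>The bound \<delta> keeps \<open>w\<close> in the region where \<open>g\<close>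
    is Lipschitz; the other bound makes the chosen points tend to \<open>y\<close>.\<close>
  have "\<exists>w v y' x'. dist w y < min \<delta> (inverse (real (Suc n))) \<and> v \<in> frechet_subdiff g w \<and>
      norm (y' - v) \<le> \<rho> \<and> x' \<in> frechet_coderivative F x y y' \<and> ereal (norm x') < c" for n
    using freq[of "min \<delta> (inverse (real (Suc n)))"] \<delta>(1)
    unfolding inf_coderivative_less_iff[OF \<rho>(1)] by auto
  then obtain w v y' x' where wv: "\<And>n. dist (w n) y < min \<delta> (inverse (real (Suc n)))"
    "\<And>n. v n \<in> frechet_subdiff g (w n)" "\<And>n. norm (y' n - v n) \<le> \<rho>"
    "\<And>n::nat. x' n \<in> frechet_coderivative F x y (y' n)" "\<And>n. ereal (norm (x' n)) < c"
    by metis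
  have "norm (v n) \<le> L" for n
    using lip(1,2) _ wv(2) by (rule frechet_subgradient_norm_le_Lipschitz)
      (use \<delta>(2) wv(1)[of n] in \<open>auto simp: dist_commute\<close>)
  then obtain l r where r: "strict_mono (r :: nat \<Rightarrow> nat)" and l: "(\<lambda>n. v (r n)) \<longlonglongrightarrow> l"
    by (rule finite_dim_dual_bounded_subseq[OF fin])
  have "w \<longlonglongrightarrow> y"
    by (rule metric_tendsto_imp_tendsto[OF LIMSEQ_inverse_real_of_nat])
      (use wv(1) in \<open>auto simp: less_imp_le dist_real_def\<close>)
  then have "(\<lambda>n. w (r n)) \<longlonglongrightarrow> y"
    using LIMSEQ_subseq_LIMSEQ[OF _ r] by (auto simp: o_def)
  then have lim: "l \<in> limiting_subdiff g y"
    unfolding limiting_subdiff_def using l wv(2) by blast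
  \<comment> \<open>Only the subgradients pass to the limit. The point \<open>(x, y)\<close> is
    fixed, so \<open>y'\<close> and \<open>x'\<close> are taken at a single index.\<close>
  obtain n where n: "dist (v (r n)) l < \<sigma> - \<rho>"
    using tendstoD[OF l, of "\<sigma> - \<rho>"] \<rho>(2) by (auto dest: eventually_happens)
  have "norm (y' (r n) - l) \<le> norm (y' (r n) - v (r n)) + norm (v (r n) - l)"
    using norm_triangle_ineq[of "y' (r n) - v (r n)" "v (r n) - l"] by simp
  also have "\<dots> \<le> \<sigma>"
    using wv(3)[of "r n"] n by (simp add: dist_norm)
  finally show thesis
    using that lim wv(4,5) by blast
qed

text \<open>Each direction starts from \<epsilon>/2: one needs room to replace a Frechet subgradient
  near \<open>y\<close> by a limiting one at \<open>y\<close>, the other needs a strict distance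
  bound between \<open>y'\<close> and the limiting subgradient.\<close>

lemma approx_strict_outer_slope_le_iff:
  fixes g :: "'y::real_normed_vector \<Rightarrow> real"
  assumes fin: "\<exists>B :: 'y set. finite B \<and> span B = UNIV"
    and lip: "\<And>y. y \<noteq> yb \<Longrightarrow> \<exists>e>0. \<exists>L. L-lipschitz_on (ball y e - {yb}) g"
  shows "approx_strict_outer_slope F g xb yb \<le> ereal L \<longleftrightarrow>
    outer_approachable (limiting_subdiff g) F xb yb L"
proof -
  have "approx_strict_outer_slope F g xb yb \<le> ereal L \<longleftrightarrow>
    (\<forall>\<epsilon>>0. \<exists>x y. (x, y) \<in> outer_gph F xb yb \<epsilon> \<and> approx_subdiff_slope_at F g \<epsilon> x y < ereal (L + \<epsilon>))"
    unfolding approx_strict_outer_slope_def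
    by (rule Lim_INF_outer_gph_le_iff)
      (auto simp: approx_subdiff_slope_at_def intro!: Liminf_mono always_eventually inf_coderivative_antimono)
  also have "\<dots> \<longleftrightarrow> outer_approachable (limiting_subdiff g) F xb yb L"
  proof
    assume *: "\<forall>\<epsilon>>0. \<exists>x y. (x, y) \<in> outer_gph F xb yb \<epsilon> \<and>
      approx_subdiff_slope_at F g \<epsilon> x y < ereal (L + \<epsilon>)"
    show "outer_approachable (limiting_subdiff g) F xb yb L"
      unfolding outer_approachable_def
    proof (intro allI impI)
      fix \<epsilon> :: real assume "\<epsilon> > 0"
      then obtain x y where xy: "(x, y) \<in> outer_gph F xb yb (\<epsilon> / 2)"
        "approx_subdiff_slope_at F g (\<epsilon> / 2) x y < ereal (L + \<epsilon> / 2)"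
        using * half_gt_zero by blast
      \<comment> \<open>Since y \<noteq> yb, the ball with \<open>yb\<close> removed is an open set
        containing \<open>y\<close>, as the preceding estimate requires.\<close>
      obtain e K where "e > 0" "K-lipschitz_on (ball y e - {yb}) g"
        using lip outer_gphD(5)[OF xy(1)] by blast
      then obtain v y' x' where "v \<in> limiting_subdiff g y" "norm (y' - v) \<le> \<epsilon>"
          "x' \<in> frechet_coderivative F x y y'" "ereal (norm x') < ereal (L + \<epsilon> / 2)"
        using approx_subdiff_slope_at_less[OF fin _ _ _ xy(2), of K "ball y e - {yb}" \<epsilon>]
          outer_gphD(5)[OF xy(1)] \<open>\<epsilon> > 0\<close> by (auto simp: open_delete)
      moreover have "(x, y) \<in> outer_gph F xb yb \<epsilon>"
        using xy(1) outer_gph_mono[of "\<epsilon> / 2" \<epsilon>] \<open>\<epsilon> > 0\<close> by auto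
      moreover from calculation(4) have "norm x' < L + \<epsilon>"
        using \<open>\<epsilon> > 0\<close> by simp
      ultimately show "\<exists>x y v y' x'. (x, y) \<in> outer_gph F xb yb \<epsilon> \<and> v \<in> limiting_subdiff g y \<and>
          norm (y' - v) \<le> \<epsilon> \<and> x' \<in> frechet_coderivative F x y y' \<and> norm x' < L + \<epsilon>"
        by blast
    qed
  next
    assume *: "outer_approachable (limiting_subdiff g) F xb yb L"
    show "\<forall>\<epsilon>>0. \<exists>x y. (x, y) \<in> outer_gph F xb yb \<epsilon> \<and>
      approx_subdiff_slope_at F g \<epsilon> x y < ereal (L + \<epsilon>)"
    proof (intro allI impI)
      fix \<epsilon> :: real assume "\<epsilon> > 0"
      obtain x y v y' x' where xy: "(x, y) \<in> outer_gph F xb yb (\<epsilon> / 2)"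
        and v: "v \<in> limiting_subdiff g y" "norm (y' - v) \<le> \<epsilon> / 2"
          "x' \<in> frechet_coderivative F x y y'" "norm x' < L + \<epsilon> / 2"
        by (rule outer_approachableD[OF * half_gt_zero[OF \<open>\<epsilon> > 0\<close>]])
      have "approx_subdiff_slope_at F g \<epsilon> x y \<le> ereal (norm x')"
        using v(1) _ v(3) by (rule approx_subdiff_slope_at_le) (use v(2) \<open>\<epsilon> > 0\<close> in linarith)
      also have "\<dots> < ereal (L + \<epsilon>)"
        using v(4) \<open>\<epsilon> > 0\<close> by simp
      finally have "approx_subdiff_slope_at F g \<epsilon> x y < ereal (L + \<epsilon>)" .
      moreover have "(x, y) \<in> outer_gph F xb yb \<epsilon>"
        using xy outer_gph_mono[of "\<epsilon> / 2" \<epsilon>] \<open>\<epsilon> > 0\<close> by auto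
      ultimately show "\<exists>x y. (x, y) \<in> outer_gph F xb yb \<epsilon> \<and> approx_subdiff_slope_at F g \<epsilon> x y < ereal (L + \<epsilon>)"
        by blast
    qed
  qed
  finally show ?thesis .
qed

section \<open>The limiting outer coderivatives and the \<epsilon>-condition\<close>

text \<open>With \<open>norm ys = 1\<close> the factor before \<open>x'\<close> disappears, so the
  \<open>x'\<close> themselves converge to \<open>xs\<close>, and any late term of the defining
  sequence is a witness.\<close>

lemma outer_approachable_of_limiting:
  assumes ys: "norm ys = 1" and xs: "xs \<in> limiting_outer_coderivative_wrt S F xb yb ys"
    and "norm xs < L + \<epsilon>" "\<epsilon> > 0"
  shows "\<exists>x y v y' x'. (x, y) \<in> outer_gph F xb yb \<epsilon> \<and> v \<in> S y \<and> norm (y' - v) \<le> \<epsilon> \<and>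
    x' \<in> frechet_coderivative F x y y' \<and> norm x' < L + \<epsilon>"
proof -
  obtain x y x' y' v' where seq: "\<And>k. (x k, y k) \<in> gph F" "\<And>k. x k \<notin> preimage F yb"
    "\<And>k. x' k \<in> frechet_coderivative F (x k) (y k) (y' k)" "\<And>k. v' k \<in> S (y k)"
    and lim: "(\<lambda>k. (x k, y k)) \<longlonglongrightarrow> (xb, yb)" "(\<lambda>k. y' k - v' k) \<longlonglongrightarrow> 0"
      "(\<lambda>k. norm ys *\<^sub>R x' k) \<longlonglongrightarrow> xs"
    using xs unfolding limiting_outer_coderivative_wrt_def by blast
  have "x \<longlonglongrightarrow> xb" "y \<longlonglongrightarrow> yb"
    using tendsto_fst[OF lim(1)] tendsto_snd[OF lim(1)] by simp_all
  then have "eventually (\<lambda>k. dist (x k) xb < \<epsilon>) sequentially" "eventually (\<lambda>k. dist (y k) yb < \<epsilon>) sequentially"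
    using \<open>\<epsilon> > 0\<close> by (auto dest: tendstoD)
  moreover have "eventually (\<lambda>k. dist (y' k - v' k) 0 < \<epsilon>) sequentially"
    using lim(2) \<open>\<epsilon> > 0\<close> by (rule tendstoD)
  moreover have "x' \<longlonglongrightarrow> xs"
    using lim(3) ys by simp
  then have "eventually (\<lambda>k. norm (x' k) < L + \<epsilon>) sequentially"
    using tendsto_norm order_tendstoD(2) assms(3) by blast
  ultimately have "eventually (\<lambda>k. (x k, y k) \<in> outer_gph F xb yb \<epsilon> \<and> norm (y' k - v' k) \<le> \<epsilon> \<and>
      norm (x' k) < L + \<epsilon>) sequentially"
    by eventually_elim (use seq(1,2) in \<open>auto simp: outer_gph_def dist_norm\<close>)
  then obtain k where "(x k, y k) \<in> outer_gph F xb yb \<epsilon>" "norm (y' k - v' k) \<le> \<epsilon>" "norm (x' k) < L + \<epsilon>"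
    by (auto dest: eventually_happens)
  then show ?thesis
    using seq(3,4) by blast
qed

text \<open>Witnesses for \<epsilon> = 1/(n+1) are thinned three times: \<open>r1\<close> makes the
  \<open>x'\<close> converge, \<open>r2\<close> decides whether the \<open>y'\<close> vanish, and
  \<open>r3\<close> makes the normalized \<open>y'\<close> converge.\<close>

lemma limiting_of_outer_approachable:
  fixes F :: "'x::real_normed_vector \<Rightarrow> 'y::real_normed_vector set"
  assumes finX: "\<exists>B :: 'x set. finite B \<and> span B = UNIV"
    and finY: "\<exists>B :: 'y set. finite B \<and> span B = UNIV"
    and appr: "outer_approachable S F xb yb L"
  obtains ys xs where "norm ys = 1" "xs \<in> limiting_outer_coderivative_wrt S F xb yb ys" "norm xs \<le> L"
proof -
  let ?\<epsilon> = "\<lambda>n. inverse (real (Suc n))"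
  have \<epsilon>: "?\<epsilon> \<longlonglongrightarrow> 0"
    by (rule LIMSEQ_inverse_real_of_nat)
  have "\<exists>x y v y' x'. (x, y) \<in> outer_gph F xb yb (?\<epsilon> n) \<and> v \<in> S y \<and> norm (y' - v) \<le> ?\<epsilon> n \<and>
      x' \<in> frechet_coderivative F x y y' \<and> norm x' < L + ?\<epsilon> n" for n
    using appr unfolding outer_approachable_def by simp
  then obtain x y v y' x' where seq: "\<And>n. (x n, y n) \<in> outer_gph F xb yb (?\<epsilon> n)" "\<And>n. v n \<in> S (y n)"
    "\<And>n. norm (y' n - v n) \<le> ?\<epsilon> n" "\<And>n. x' n \<in> frechet_coderivative F (x n) (y n) (y' n)"
    "\<And>n. norm (x' n) < L + ?\<epsilon> n"
    by metis
  \<comment> \<open>All tolerances are at most 1, hence the uniform bound.\<close>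
  have "norm (x' n) \<le> L + 1" for n
    using seq(5)[of n] by (rule less_imp_le[OF less_le_trans]) (simp add: field_simps)
  then obtain r1 xs where r1: "strict_mono (r1 :: nat \<Rightarrow> nat)" "(\<lambda>n. x' (r1 n)) \<longlonglongrightarrow> xs"
    by (rule finite_dim_dual_bounded_subseq[OF finX])
  obtain r2 where r2: "strict_mono (r2 :: nat \<Rightarrow> nat)"
    "(\<forall>n. y' (r1 (r2 n)) = 0) \<or> (\<forall>n. y' (r1 (r2 n)) \<noteq> 0)"
    using subseq_all_or_none[of "\<lambda>n. y' (r1 n) = 0"] by blast
  obtain r3 ys where r3: "strict_mono (r3 :: nat \<Rightarrow> nat)" "norm ys = 1"
    "(\<forall>n. y' (r1 (r2 (r3 n))) \<noteq> 0) \<and>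
       (\<lambda>n. y' (r1 (r2 (r3 n))) /\<^sub>R norm (y' (r1 (r2 (r3 n))))) \<longlonglongrightarrow> ys /\<^sub>R norm ys \<or>
     (\<forall>n. y' (r1 (r2 (r3 n))) = 0)"
  proof (cases "\<forall>n. y' (r1 (r2 n)) = 0")
    case True
    \<comment> \<open>When every \<open>y'\<close> is zero the definition allows any unit
      \<open>ys\<close>; one exists because two distinct points show that \<open>Y\<close> is
      nontrivial.\<close>
    have "y 0 - yb \<noteq> 0"
      using outer_gphD(5)[OF seq(1)] by simp
    then obtain ys :: "'y dual" where "norm ys = 1"
      using finite_dim_dual_unit_exists[OF finY] by blast
    then show thesis
      using True by (intro that[of "\<lambda>n. n"]) (auto simp: strict_mono_def)
  next
    case False
    then have nz: "y' (r1 (r2 n)) \<noteq> 0" for n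
      using r2(2) by blast
    then have one: "norm (y' (r1 (r2 n)) /\<^sub>R norm (y' (r1 (r2 n)))) = 1" for n
      by simp
    obtain r3 ys where r3: "strict_mono (r3 :: nat \<Rightarrow> nat)"
      "(\<lambda>n. y' (r1 (r2 (r3 n))) /\<^sub>R norm (y' (r1 (r2 (r3 n))))) \<longlonglongrightarrow> ys"
      by (rule finite_dim_dual_bounded_subseq[OF finY eq_refl[OF one]])
    have "norm ys = 1"
      using tendsto_norm[OF r3(2)] unfolding one by (simp add: LIMSEQ_const_iff)
    then show thesis
      using r3 nz by (intro that[of r3 ys]) auto
  qed
  define r where "r = (\<lambda>n. r1 (r2 (r3 n)))"
  have r: "strict_mono r"
    using r1(1) r2(1) r3(1) by (simp add: r_def strict_mono_def)
  have sub: "(\<lambda>n. u (r n)) \<longlonglongrightarrow> l" if "u \<longlonglongrightarrow> l" for u :: "nat \<Rightarrow> 'z::topological_space" and l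
    using LIMSEQ_subseq_LIMSEQ[OF that r] by (simp add: o_def)
  have "x \<longlonglongrightarrow> xb" "y \<longlonglongrightarrow> yb"
    using outer_gphD(3,4)[OF seq(1)]
    by (auto intro!: metric_tendsto_imp_tendsto[OF \<epsilon>] always_eventually less_imp_le simp: dist_norm)
  then have "(\<lambda>n. (x (r n), y (r n))) \<longlonglongrightarrow> (xb, yb)"
    by (intro tendsto_Pair sub)
  moreover have "(\<lambda>n. y' n - v n) \<longlonglongrightarrow> 0"
    using seq(3) by (intro Lim_null_comparison[OF _ \<epsilon>] always_eventually) auto
  then have "(\<lambda>n. y' (r n) - v (r n)) \<longlonglongrightarrow> 0"
    by (rule sub)
  \<comment> \<open>The limit \<open>xs\<close> is known only along \<open>r1\<close>, so the
    convergence comes from \<open>r\<close> being a further subsequence of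
    \<open>r1\<close>.\<close>
  moreover have xs: "(\<lambda>n. x' (r n)) \<longlonglongrightarrow> xs"
    using LIMSEQ_subseq_LIMSEQ[OF r1(2), of "\<lambda>n. r2 (r3 n)"] r2(1) r3(1)
    by (simp add: r_def o_def strict_mono_def)
  then have "(\<lambda>n. norm ys *\<^sub>R x' (r n)) \<longlonglongrightarrow> xs"
    using r3(2) by simp
  ultimately have "xs \<in> limiting_outer_coderivative_wrt S F xb yb ys"
    unfolding limiting_outer_coderivative_wrt_def
    using outer_gphD(1,2)[OF seq(1)] seq(2,4) r3(3)[folded fun_cong[OF r_def]]
    by - (rule CollectI, rule exI[of _ "\<lambda>n. x (r n)"], rule exI[of _ "\<lambda>n. y (r n)"],
        rule exI[of _ "\<lambda>n. x' (r n)"], rule exI[of _ "\<lambda>n. y' (r n)"],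
        rule exI[of _ "\<lambda>n. v (r n)"], simp)
  moreover have "norm xs \<le> L"
  proof (rule LIMSEQ_le[OF tendsto_norm[OF xs]])
    show "(\<lambda>n. L + ?\<epsilon> (r n)) \<longlonglongrightarrow> L"
      using tendsto_add[OF tendsto_const sub[OF \<epsilon>]] by simp
    show "\<exists>N. \<forall>n\<ge>N. norm (x' (r n)) \<le> L + ?\<epsilon> (r n)"
      using seq(5) less_imp_le by blast
  qed
  ultimately show thesis
    using that r3(2) by blast
qed

text \<open>From left to right the infimum is not assumed attained; for each \<epsilon> an element
  of norm below \<open>L + \<epsilon>\<close> suffices. Conversely, compactness yields an element of
  norm at most \<open>L\<close>.\<close>

lemma INF_limiting_outer_coderivative_le_iff:
  fixes F :: "'x::real_normed_vector \<Rightarrow> 'y::real_normed_vector set"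
  assumes finX: "\<exists>B :: 'x set. finite B \<and> span B = UNIV"
    and finY: "\<exists>B :: 'y set. finite B \<and> span B = UNIV"
  shows "(INF x'\<in>set_image (limiting_outer_coderivative_wrt S F xb yb) (sphere 0 1). ereal (norm x'))
      \<le> ereal L \<longleftrightarrow> outer_approachable S F xb yb L" (is "?I \<le> _ \<longleftrightarrow> _")
proof
  assume le: "?I \<le> ereal L"
  show "outer_approachable S F xb yb L"
    unfolding outer_approachable_def
  proof (intro allI impI)
    fix \<epsilon> :: real assume "\<epsilon> > 0"
    then have "?I < ereal (L + \<epsilon>)"
      by (intro le_less_trans[OF le]) simp
    then obtain xs where "xs \<in> set_image (limiting_outer_coderivative_wrt S F xb yb) (sphere 0 1)"
      "norm xs < L + \<epsilon>"
      unfolding INF_less_iff by auto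
    then obtain ys where "norm ys = 1" "xs \<in> limiting_outer_coderivative_wrt S F xb yb ys"
      "norm xs < L + \<epsilon>"
      unfolding set_image_def by auto
    then show "\<exists>x y v y' x'. (x, y) \<in> outer_gph F xb yb \<epsilon> \<and> v \<in> S y \<and> norm (y' - v) \<le> \<epsilon> \<and>
        x' \<in> frechet_coderivative F x y y' \<and> norm x' < L + \<epsilon>"
      using \<open>\<epsilon> > 0\<close> by (rule outer_approachable_of_limiting)
  qed
next
  assume "outer_approachable S F xb yb L"
  then obtain ys xs where "norm ys = 1" "xs \<in> limiting_outer_coderivative_wrt S F xb yb ys" "norm xs \<le> L"
    using limiting_of_outer_approachable[OF finX finY] by blast
  then show "?I \<le> ereal L"
    by (intro INF_lower2[of xs]) (auto simp: set_image_def)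
qed

section \<open>Equality from common real upper bounds\<close>

text \<open>An extended real is determined by its real upper bounds, with none for \<infinity>.
  Testing real \<open>L\<close> therefore also covers infima over empty sets.\<close>

lemma ereal_eqI_le_real:
  fixes a b :: ereal
  assumes "\<And>L. a \<le> ereal L \<longleftrightarrow> b \<le> ereal L"
  shows "a = b"
proof (rule antisym)
  show "a \<le> b" by (rule ereal_le_real) (simp only: assms)
  show "b \<le> a" by (rule ereal_le_real) (simp only: assms)
qed

lemma outer_slopes_eq_INF_limiting:
  fixes F :: "'x::real_normed_vector \<Rightarrow> 'y::real_normed_vector set"
  assumes finite_dim_X: "\<exists>B :: 'x set. finite B \<and> span B = UNIV"
    and finite_dim_Y: "\<exists>B :: 'y set. finite B \<and> span B = UNIV"
    and g_loc_lipschitz: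
      "\<And>y. y \<noteq> yb \<Longrightarrow> \<exists>e>0. \<exists>L. L-lipschitz_on (ball y e - {yb}) g"
  shows "strict_outer_slope F g xb yb =
           (INF x'\<in>set_image (limiting_outer_coderivative F g xb yb) (sphere 0 1). ereal (norm x')) \<and>
         approx_strict_outer_slope F g xb yb =
           (INF x'\<in>set_image (approx_limiting_outer_coderivative F g xb yb) (sphere 0 1). ereal (norm x'))"
proof
  have approx_iff: "approx_strict_outer_slope F g xb yb \<le> ereal L \<longleftrightarrow>
      outer_approachable (limiting_subdiff g) F xb yb L" for L
    using finite_dim_Y g_loc_lipschitz by (rule approx_strict_outer_slope_le_iff)
  show "strict_outer_slope F g xb yb =
      (INF x'\<in>set_image (limiting_outer_coderivative F g xb yb) (sphere 0 1). ereal (norm x'))"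
    unfolding limiting_outer_coderivative_def
    by (rule ereal_eqI_le_real) (simp only: strict_outer_slope_le_iff
        INF_limiting_outer_coderivative_le_iff[OF finite_dim_X finite_dim_Y])
  show "approx_strict_outer_slope F g xb yb =
      (INF x'\<in>set_image (approx_limiting_outer_coderivative F g xb yb) (sphere 0 1). ereal (norm x'))"
    unfolding approx_limiting_outer_coderivative_def
    by (rule ereal_eqI_le_real) (simp only: approx_iff
        INF_limiting_outer_coderivative_le_iff[OF finite_dim_X finite_dim_Y])
qed

theorem proposition4p4:
  fixes F :: "'x::real_normed_vector \<Rightarrow> 'y::real_normed_vector set"
    and g :: "'y \<Rightarrow> real" and xb :: 'x and yb :: 'y
  assumes finite_dim_X: "\<exists>B :: 'x set. finite B \<and> span B = UNIV"
    and finite_dim_Y: "\<exists>B :: 'y set. finite B \<and> span B = UNIV"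
    and in_gph: "(xb, yb) \<in> gph F"
    and g_nonneg: "\<And>y. g y \<ge> 0"
    and g_zero: "g yb = 0"
    and g_cont: "isCont g yb"
    and g_loc_lipschitz:
      "\<And>y. y \<noteq> yb \<Longrightarrow> \<exists>e>0. \<exists>L. L-lipschitz_on (ball y e - {yb}) g"
    and g_pos: "\<And>y. y \<noteq> yb \<Longrightarrow> g y > 0"
    and g_liminf:
      "Liminf (filtercomap g (at_right 0)) (\<lambda>y. ereal (g y / norm (y - yb))) > 0"
  shows "strict_outer_slope F g xb yb =
           (INF x'\<in>set_image (limiting_outer_coderivative F g xb yb) (sphere 0 1). ereal (norm x')) \<and>
         approx_strict_outer_slope F g xb yb =
           (INF x'\<in>set_image (approx_limiting_outer_coderivative F g xb yb) (sphere 0 1). ereal (norm x'))"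
  using finite_dim_X finite_dim_Y g_loc_lipschitz by (rule outer_slopes_eq_INF_limiting)

end
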